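(* Let $S = \langle a, ah+d, ah+2d, \ldots, ah+kd\rangle$ be an extra-generalized arithmetical numerical semigroup, and suppose $1<k<a-2$. The extremal rays of the face $F\subset\mathcal{C}(\mathbb{Z}_a)$ containing $S$ are spanned by the following: (i) the vector $\vec r$ that, when added to the Kunz coordinates of $S$ in $P_a$, yields (the Kunz coordinates of) $$\langle a, ah+(d+a), \ldots, ah+k(d+a)\rangle;$$ and (ii) the vector $\vec t$ that, when added to the Kunz coordinates of $S$ in $P_a$, yields (the Kunz coordinates of) $$\langle a, a(h+a)+(d-a\lfloor a/k\rfloor),\ldots, a(h+a)+k(d-a\lfloor a/k\rfloor)\rangle.$$ The ray $\vec r$ contains all of the numerical semigroups $\langle a,b\rangle$ for positive $b\equiv d \bmod a$, and the ray $\vec t$ contains numerical semigroups if $k\mid(a-1)$, in which case those semigroups have the form $\langle a,b\rangle$ for some positive $b\equiv kd\bmod a$.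
   Context: A numerical semigroup is a subset $S \subseteq \mathbb{Z}_{\ge 0}$ containing $0$, closed under addition, with finite complement; $\langle n_1,\ldots,n_k\rangle$ denotes the set of all non-negative integer combinations of $n_1,\ldots,n_k$. For $m \in S$, $m>0$, the Apéry set $\operatorname{Ap}(S;m) = \{n \in S : n-m\notin S\}$ has exactly one element in each residue class modulo $m$; write $\operatorname{Ap}(S;m) = \{0,a_1,\ldots,a_{m-1}\}$ with $a_i = mz_i+i$ for $1\le i\le m-1$. The tuple $(a_1,\ldots,a_{m-1})$ is the Apéry tuple of $S$ and $(z_1,\ldots,z_{m-1})$ is the tuple of Kunz coordinates of $S$ (with respect to $m$). For $m\ge 2$, the group cone $\mathcal{C}(\mathbb{Z}_m)\subset\mathbb{R}^{m-1}$ (coordinates indexed by $\mathbb{Z}_m\setminus\{0\}$) is the cone defined by the inequalities $x_i+x_j\ge x_{i+j}$ for $i,j\in\mathbb{Z}_m\setminus\{0\}$ with $i+j\ne 0$. The Kunz polyhedron $P_m$ is the translate of $\mathcal{C}(\mathbb{Z}_m)$ with vertex $(-\tfrac1m,\ldots,-\tfrac{m-1}{m})$; its integer points are exactly the Kunz coordinate tuples of numerical semigroups containing $m$. A face (in particular a ray) $F$ of $\mathcal{C}(\mathbb{Z}_m)$ contains a numerical semigroup $S$ (with $m\in S$) if the Apéry tuple of $S$ lies in the relative interior of $F$. An extra-generalized arithmetical numerical semigroup is a numerical semigroup of the form $S = \langle a, ah+d, ah+2d,\ldots, ah+kd\rangle$ with $a,h,k \in \mathbb{Z}_{\ge 1}$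 and $d\in\mathbb{Z}$ such that $k<a$, $\gcd(a,d)=1$, and $ah+kd>a$.
   Formalization: The listed generators a, ah+d, …, ah+kd are additionally assumed to be a minimal generating set of S; without this the claim fails, e.g. for a=5, h=10, k=2, d=−22, where S=⟨5,6⟩ lies on a single ray not containing r. *)

theory Defs
  imports "HOL-Analysis.Analysis" "HOL-Number_Theory.Cong"
begin

text \<open>
  Semigroups are sets of integers contained in \<open>{0..}\<close>, so that differences are taken
  in the integers and nothing is truncated.
\<close>

definition numerical_semigroup :: "int set \<Rightarrow> bool" where
  "numerical_semigroup S \<longleftrightarrow>
     S \<subseteq> {0..} \<and> 0 \<in> S \<and> (\<forall>x\<in>S. \<forall>y\<in>S. x + y \<in> S) \<and> finite ({0..} - S)"

text \<open>Meant for finite \<open>G\<close> only: the sum over an infinite set is zero by convention.\<close>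

definition sg_gen :: "int set \<Rightarrow> int set" where
  "sg_gen G = {\<Sum>g\<in>G. int (c g) * g | c :: int \<Rightarrow> nat. True}"

definition minimally_generating :: "int set \<Rightarrow> bool" where
  "minimally_generating G \<longleftrightarrow> (\<forall>g\<in>G. g \<notin> sg_gen (G - {g}))"

definition apery_set :: "int set \<Rightarrow> int \<Rightarrow> int set" where
  "apery_set S m = {n \<in> S. n - m \<notin> S}"

definition apery_elem :: "int set \<Rightarrow> int \<Rightarrow> int \<Rightarrow> int" where
  "apery_elem S m i = (THE n. n \<in> apery_set S m \<and> [n = i] (mod m))"

text \<open>
  The coordinates of \<open>\<real>\<^sup>m\<^sup>-\<^sup>1\<close> are indexed by the nonzero residues modulo \<open>m\<close>.
  An arbitrary bijection \<open>\<sigma>\<close> from the index type onto the representatives \<open>1, \<dots>, m - 1\<close>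
  gives this labelling; it forces the index type to have \<open>m - 1\<close> elements and \<open>m \<ge> 2\<close>.
\<close>

definition residue_labelling :: "('n::finite \<Rightarrow> int) \<Rightarrow> int \<Rightarrow> bool" where
  "residue_labelling \<sigma> m \<longleftrightarrow> bij_betw \<sigma> UNIV {1..m - 1}"

definition apery_tuple :: "('n::finite \<Rightarrow> int) \<Rightarrow> int \<Rightarrow> int set \<Rightarrow> real ^ 'n" where
  "apery_tuple \<sigma> m S = (\<chi> i. real_of_int (apery_elem S m (\<sigma> i)))"

text \<open>The entry \<open>z\<close> at the residue \<open>i\<close> solves \<open>a\<^sub>i = m z + i\<close>.\<close>

definition kunz_coords :: "('n::finite \<Rightarrow> int) \<Rightarrow> int \<Rightarrow> int set \<Rightarrow> real ^ 'n" where
  "kunz_coords \<sigma> m S =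
     (\<chi> i. (real_of_int (apery_elem S m (\<sigma> i)) - real_of_int (\<sigma> i)) / real_of_int m)"

text \<open>
  The existence of an index \<open>l\<close> labelled by the residue of \<open>\<sigma> i + \<sigma> j\<close> says that this
  residue is nonzero.
\<close>

definition group_cone :: "('n::finite \<Rightarrow> int) \<Rightarrow> int \<Rightarrow> (real ^ 'n) set" where
  "group_cone \<sigma> m =
     {x. \<forall>i j l. [\<sigma> i + \<sigma> j = \<sigma> l] (mod m) \<longrightarrow> x $ i + x $ j \<ge> x $ l}"

definition contains_semigroup ::
    "('n::finite \<Rightarrow> int) \<Rightarrow> int \<Rightarrow> (real ^ 'n) set \<Rightarrow> int set \<Rightarrow> bool" where
  "contains_semigroup \<sigma> m F S \<longleftrightarrow>
     numerical_semigroup S \<and> m \<in> S \<and> apery_tuple \<sigma> m S \<in> rel_interior F"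

text \<open>The ray \<open>{c *\<^sub>R v | c \<ge> 0}\<close>.\<close>

abbreviation ray :: "'a::real_vector \<Rightarrow> 'a set" where
  "ray v \<equiv> cone hull {v}"

definition extremal_rays :: "'a::real_vector set \<Rightarrow> 'a set set" where
  "extremal_rays F = {R. R face_of F \<and> (\<exists>v. v \<noteq> 0 \<and> R = ray v)}"

definition arith_gens :: "int \<Rightarrow> int \<Rightarrow> int \<Rightarrow> int \<Rightarrow> int set" where
  "arith_gens a h k d = insert a {a * h + i * d | i. i \<in> {1..k}}"

definition extra_generalized_arithmetical ::
    "int \<Rightarrow> int \<Rightarrow> int \<Rightarrow> int \<Rightarrow> int set \<Rightarrow> bool" where
  "extra_generalized_arithmetical a h k d S \<longleftrightarrow>
     numerical_semigroup S \<and> S = sg_gen (arith_gens a h k d) \<and>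
     a \<ge> 1 \<and> h \<ge> 1 \<and> k \<ge> 1 \<and> k < a \<and> gcd a d = 1 \<and> a * h + k * d > a"

end

theory Submission
  imports Defs
begin

text \<open>
  List the residues modulo \<open>a\<close> as \<open>j d\<close> with \<open>0 \<le> j < a\<close>, and put \<open>q = \<lfloor>a/k\<rfloor>\<close>. The element of the
  Apery set of \<open>S\<close> at \<open>j d\<close> is \<open>\<lceil>j/k\<rceil> a h + j d\<close>; this needs \<open>h q + d \<ge> 0\<close>, and minimality of the
  generators gives \<open>h q + d > 0\<close>. Hence the facet inequalities that are tight at \<open>S\<close> are those for
  \<open>i + j < a\<close> with \<open>\<lceil>i/k\<rceil> + \<lceil>j/k\<rceil> = \<lceil>(i+j)/k\<rceil>\<close>. As \<open>k < a - 2\<close>, the equations with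
  \<open>i + j = k + 1\<close> and \<open>i + j = k + 2\<close> force a solution to be affine on \<open>1, \<dots>, k\<close>, and adding \<open>k\<close>
  repeatedly shows that it is \<open>\<alpha> \<lceil>j/k\<rceil> + \<beta> j\<close>. On this plane the cone is cut out by \<open>\<alpha> \<ge> 0\<close> and
  \<open>\<alpha> q + \<beta> a \<ge> 0\<close>, so its two rays are spanned by \<open>j\<close> and by \<open>a \<lceil>j/k\<rceil> - q j\<close>. If \<open>k q = a - 1\<close>,
  the latter is the representative in \<open>1, \<dots>, a - 1\<close> of \<open>j/k\<close> modulo \<open>a\<close>, which is the shape of the Apery
  tuple of a semigroup with two generators.
\<close>

subsection \<open>Rounded-up division\<close>

definition ceil_div :: "int \<Rightarrow> int \<Rightarrow> int" where
  "ceil_div j k = - (- j div k)"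

text \<open>The adjunction that characterises rounding up; the inequalities for
  \<open>ceil_div\<close> below rest on it.\<close>

lemma ceil_div_le_iff:
  assumes "k > 0"
  shows "ceil_div j k \<le> n \<longleftrightarrow> j \<le> k * n"
proof -
  have "(- j + n * k) div k = n + - j div k"
    by (rule div_mult_self1) (use assms in simp)
  then show ?thesis
    using pos_imp_zdiv_nonneg_iff[OF assms, of "- j + n * k"]
    unfolding ceil_div_def by (auto simp: mult.commute)
qed

lemma ceil_div_eq:
  assumes "1 \<le> u" "u \<le> k"
  shows "ceil_div (k * p + u) k = p + 1"
proof (rule antisym)
  show "ceil_div (k * p + u) k \<le> p + 1"
    using assms by (subst ceil_div_le_iff) (auto simp: algebra_simps)
  have "\<not> ceil_div (k * p + u) k \<le> p"
    using assms by (subst ceil_div_le_iff) auto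
  then show "p + 1 \<le> ceil_div (k * p + u) k" by simp
qed

lemma ceil_div_eq_1:
  assumes "1 \<le> u" "u \<le> k"
  shows "ceil_div u k = 1"
  using ceil_div_eq[OF assms, of 0] by simp

lemma ceil_div_0 [simp]: "ceil_div 0 k = 0"
  by (simp add: ceil_div_def)

lemma ceil_div_1_right [simp]: "ceil_div j 1 = j"
  by (simp add: ceil_div_def)

lemma le_mult_ceil_div: "k > 0 \<Longrightarrow> j \<le> k * ceil_div j k"
  using ceil_div_le_iff[of k j "ceil_div j k"] by simp

lemma ceil_div_add_le: "k > 0 \<Longrightarrow> ceil_div (i + j) k \<le> ceil_div i k + ceil_div j k"
  using le_mult_ceil_div[of k i] le_mult_ceil_div[of k j]
  by (simp add: ceil_div_le_iff algebra_simps)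

text \<open>Applied with \<open>l\<close> a multiple of \<open>a\<close> and \<open>p\<close> the
  same multiple of \<open>a div k\<close>, it bounds from below how much the rounded quotient grows
  when an index wraps around modulo \<open>a\<close>.\<close>

lemma ceil_div_add_mult:
  assumes "k > 0" "k * p \<le> l"
  shows "ceil_div j k + p \<le> ceil_div (j + l) k"
proof -
  have "j \<le> k * (ceil_div (j + l) k - p)"
    using le_mult_ceil_div[of k "j + l"] assms by (simp add: algebra_simps)
  then show ?thesis
    using assms by (simp add: ceil_div_le_iff[symmetric])
qed

text \<open>Remainders run through \<open>1..k\<close> and not \<open>0..k - 1\<close>, so that
  \<open>ceil_div\<close> has the constant value \<open>p + 1\<close> on each block.\<close>

lemma remainder_decomp:
  fixes j k :: int
  assumes "k > 0" "j \<ge> 1"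
  obtains p u where "p \<ge> 0" "1 \<le> u" "u \<le> k" "j = k * p + u"
proof
  show "(j - 1) div k \<ge> 0" using assms by (simp add: pos_imp_zdiv_nonneg_iff)
  show "1 \<le> (j - 1) mod k + 1" using assms by simp
  show "(j - 1) mod k + 1 \<le> k" using assms by (simp add: pos_mod_bound add1_zle_eq)
  show "j = k * ((j - 1) div k) + ((j - 1) mod k + 1)" by simp
qed

subsection \<open>Generated semigroups and Apery sets\<close>

lemma sg_gen_0: "0 \<in> sg_gen G"
  unfolding sg_gen_def by (force intro: exI[of _ "\<lambda>_. 0"])

lemma sg_gen_add:
  assumes "x \<in> sg_gen G" "y \<in> sg_gen G"
  shows "x + y \<in> sg_gen G"
proof -
  obtain c e where "x = (\<Sum>g\<in>G. int (c g) * g)" "y = (\<Sum>g\<in>G. int (e g) * g)"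
    using assms unfolding sg_gen_def by auto
  then have "x + y = (\<Sum>g\<in>G. int (c g + e g) * g)"
    by (simp add: sum.distrib algebra_simps)
  then show ?thesis unfolding sg_gen_def by (intro CollectI exI[of _ "\<lambda>g. c g + e g"]) simp
qed

lemma sg_gen_generator:
  assumes "finite G" "g \<in> G"
  shows "g \<in> sg_gen G"
proof -
  have "(\<Sum>x\<in>G. int (if x = g then 1 else 0) * x) = (\<Sum>x\<in>G. if x = g then x else 0)"
    by (intro sum.cong) auto
  also have "\<dots> = g" using assms by simp
  finally show ?thesis unfolding sg_gen_def
    by (auto intro!: exI[of _ "\<lambda>x. if x = g then 1 else 0"])
qed

lemma closed_mult:
  fixes S :: "int set"
  assumes "0 \<in> S" "\<And>x y. x \<in> S \<Longrightarrow> y \<in> S \<Longrightarrow> x + y \<in> S" "x \<in> S" "n \<ge> 0"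
  shows "n * x \<in> S"
proof -
  have "int m * x \<in> S" for m
    by (induction m) (auto simp: algebra_simps assms)
  from this[of "nat n"] show ?thesis using assms by simp
qed

lemma sg_gen_mult: "x \<in> sg_gen G \<Longrightarrow> n \<ge> 0 \<Longrightarrow> n * x \<in> sg_gen G"
  using closed_mult[of "sg_gen G"] sg_gen_0 sg_gen_add by blast

text \<open>A combination arises from 0 by adding one generator at a time; this hides the
  coefficient function from later arguments.\<close>

lemma sg_gen_induct [consumes 2, case_names zero add]:
  assumes "finite G" "x \<in> sg_gen G"
    and zero: "P 0" and add: "\<And>g x. g \<in> G \<Longrightarrow> P x \<Longrightarrow> P (x + g)"
  shows "P x"
proof -
  obtain c where x: "x = (\<Sum>g\<in>G. int (c g) * g)"
    using assms(2) unfolding sg_gen_def by auto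
  have "P (\<Sum>g\<in>H. int (c g) * g)" if "H \<subseteq> G" for H
    using finite_subset[OF that assms(1)] that
  proof (induction H rule: finite_induct)
    case empty
    then show ?case using zero by simp
  next
    case (insert g H)
    have "P ((\<Sum>g\<in>H. int (c g) * g) + int n * g)" for n
    proof (induction n)
      case 0
      then show ?case using insert by simp
    next
      case (Suc n)
      then show ?case using add[OF _ Suc, of g] insert by (simp add: algebra_simps)
    qed
    from this[of "c g"] show ?case using insert by (simp add: add.commute)
  qed
  then show ?thesis using x by simp
qed

lemma sg_gen_subset:
  assumes "finite G" "G \<subseteq> S" "0 \<in> S" "\<And>x y. x \<in> S \<Longrightarrow> y \<in> S \<Longrightarrow> x + y \<in> S"
  shows "sg_gen G \<subseteq> S"
proof
  fix x
  assume "x \<in> sg_gen G"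
  with assms(1) show "x \<in> S"
    by (induction rule: sg_gen_induct) (use assms in auto)
qed

lemma finite_arith_gens: "finite (arith_gens a h k d)"
proof -
  have "{a * h + i * d |i. i \<in> {1..k}} = (\<lambda>i. a * h + i * d) ` {1..k}" by auto
  then show ?thesis unfolding arith_gens_def by simp
qed

text \<open>Otherwise \<open>y - a\<close> would be \<open>x\<close> plus a nonnegative multiple of
  \<open>a\<close>, hence in \<open>S\<close>. So an Apery element is the least element of its
  class.\<close>

lemma apery_le:
  assumes "a > 0" and closed: "\<And>x. x \<in> S \<Longrightarrow> x + a \<in> S"
    and "x \<in> S" "y - a \<notin> S" "[x = y] (mod a)"
  shows "y \<le> (x :: int)"
proof (rule ccontr)
  assume "\<not> y \<le> x"
  obtain l where l: "y = x + a * l"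
    using assms(5) by (metis cong_iff_lin)
  with \<open>\<not> y \<le> x\<close> have "0 < a * l" by simp
  then have "l > 0" using \<open>a > 0\<close> by (rule zero_less_mult_pos)
  have "x + int n * a \<in> S" for n
  proof (induction n)
    case (Suc n)
    then show ?case using closed[OF Suc] by (simp add: algebra_simps)
  qed (use assms in simp)
  moreover have "y - a = x + int (nat (l - 1)) * a" using l \<open>l > 0\<close> by (simp add: algebra_simps)
  ultimately show False using assms(4) by metis
qed

text \<open>Uniqueness behind the definite description: two candidates bound each other by
  \<open>apery_le\<close>.\<close>

lemma apery_elem_eqI:
  assumes "a > 0" and closed: "\<And>x. x \<in> S \<Longrightarrow> x + a \<in> S"
    and w: "w \<in> S" "w - a \<notin> S" "[w = i] (mod a)"
  shows "apery_elem S a i = w"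
  unfolding apery_elem_def apery_set_def
proof (rule the_equality)
  show "w \<in> {n \<in> S. n - a \<notin> S} \<and> [w = i] (mod a)" using w by simp
next
  fix v
  assume v: "v \<in> {n \<in> S. n - a \<notin> S} \<and> [v = i] (mod a)"
  then have "[v = w] (mod a)" "[w = v] (mod a)" using w by (meson cong_sym cong_trans)+
  then show "v = w"
    using apery_le[OF assms(1) closed, of v w] apery_le[OF assms(1) closed, of w v] v w by simp
qed

text \<open>Finiteness of the complement makes \<open>S\<close> meet every residue class, and the
  least element of \<open>S\<close> in a class is its Apery element. So the definite description
  denotes.\<close>

lemma apery_elem_props:
  assumes "a > 0" "numerical_semigroup S" "a \<in> S"
  shows "apery_elem S a i \<in> S" "apery_elem S a i - a \<notin> S" "[apery_elem S a i = i] (mod a)"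
proof -
  have closed: "x + a \<in> S" if "x \<in> S" for x
    using assms that unfolding numerical_semigroup_def by auto
  define Q where "Q n \<longleftrightarrow> int n \<in> S \<and> [int n = i] (mod a)" for n
  have "\<exists>n. Q n"
  proof (rule ccontr)
    assume none: "\<nexists>n. Q n"
    have "range (\<lambda>n. i mod a + a * int n) \<subseteq> {0..} - S"
    proof (rule image_subsetI)
      fix n :: nat
      let ?x = "i mod a + a * int n"
      have 1: "?x \<ge> 0" using assms(1) by simp
      have "?x \<notin> S"
      proof
        assume "?x \<in> S"
        with 1 have "Q (nat ?x)" unfolding Q_def by (simp add: cong_def)
        then show False using none by blast
      qed
      with 1 show "?x \<in> {0..} - S" by simp
    qed
    moreover have "inj (\<lambda>n. i mod a + a * int n)" using assms(1) by (auto intro: injI)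
    ultimately have "finite (UNIV :: nat set)"
      using assms(2) unfolding numerical_semigroup_def
      by (meson finite_imageD finite_subset)
    then show False by simp
  qed
  then have L: "Q (LEAST n. Q n)" and least: "\<And>m. Q m \<Longrightarrow> (LEAST n. Q n) \<le> m"
    by (auto intro: LeastI_ex Least_le)
  define w where "w = int (LEAST n. Q n)"
  have w: "w \<in> S" "[w = i] (mod a)" using L unfolding w_def Q_def by auto
  have w': "w - a \<notin> S"
  proof
    assume "w - a \<in> S"
    moreover from this have "w - a \<ge> 0" using assms(2) unfolding numerical_semigroup_def by auto
    ultimately have "Q (nat (w - a))" using w unfolding Q_def by (auto simp: cong_def)
    from least[OF this] show False using assms(1) \<open>w - a \<ge> 0\<close> unfolding w_def by auto
  qed
  have "apery_elem S a i = w" by (rule apery_elem_eqI[OF assms(1) closed w(1) w' w(2)])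
  then show "apery_elem S a i \<in> S" "apery_elem S a i - a \<notin> S" "[apery_elem S a i = i] (mod a)"
    using w w' by auto
qed

text \<open>Adding multiples of \<open>a\<close> stays in \<open>S\<close>, so each gap lies below
  the chosen element of its class, and finitely many classes give a common bound
  \<open>W\<close>.\<close>

lemma numerical_semigroupI:
  assumes "a > 0" "S \<subseteq> {0..}" "0 \<in> S" "a \<in> S"
    and closed: "\<And>x y. x \<in> S \<Longrightarrow> y \<in> S \<Longrightarrow> x + y \<in> S"
    and classes: "\<And>i. \<exists>w\<in>S. [w = i] (mod a)"
  shows "numerical_semigroup S"
proof -
  obtain w where w: "\<And>i. w i \<in> S" "\<And>i. [w i = i] (mod a)" using classes by metis
  define W where "W = Max (w ` {0..<a})"
  have "{0..} - S \<subseteq> {0..W}"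
  proof
    fix x
    assume x: "x \<in> {0..} - S"
    have "[w (x mod a) = x] (mod a)" using w(2)[of "x mod a"] by (simp add: cong_def)
    then obtain l where l: "x = w (x mod a) + a * l" by (metis cong_iff_lin)
    have "w (x mod a) \<le> W" unfolding W_def using assms(1) by (intro Max_ge) auto
    moreover have "x < w (x mod a)"
    proof (rule ccontr)
      assume "\<not> x < w (x mod a)"
      then have "l \<ge> 0" using l assms(1) by (smt (verit) mult_pos_neg)
      then have "l * a \<in> S" using closed_mult assms by blast
      then show False using x l closed[OF w(1), of "l * a"] by (simp add: mult.commute) (metis)
    qed
    ultimately show "x \<in> {0..W}" using x by simp
  qed
  then have "finite ({0..} - S)" using finite_subset by blast
  then show ?thesis unfolding numerical_semigroup_def using assms by blast
qed

text \<open>Here \<open>n\<close> counts the generators \<open>a * h + i * d\<close> in use,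
  \<open>s\<close> is the sum of their indices, each at most \<open>k\<close>, and \<open>m\<close>
  counts the copies of \<open>a\<close>.\<close>

lemma arith_gens_lin:
  assumes "x \<in> sg_gen (arith_gens a h k d)"
  shows "\<exists>n s m. 0 \<le> n \<and> 0 \<le> s \<and> s \<le> k * n \<and> 0 \<le> m \<and> x = n * (a * h) + s * d + m * a"
  using finite_arith_gens assms
proof (induction rule: sg_gen_induct)
  case zero
  show ?case by (intro exI[of _ 0]) auto
next
  case (add g x)
  then obtain n s m where *: "0 \<le> n" "0 \<le> s" "s \<le> k * n" "0 \<le> m" "x = n * (a * h) + s * d + m * a"
    by blast
  from add(1) consider "g = a" | i where "g = a * h + i * d" "1 \<le> i" "i \<le> k"
    unfolding arith_gens_def by auto
  then show ?case
  proof cases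
    case 1
    then show ?thesis using * by (intro exI[of _ n] exI[of _ s] exI[of _ "m + 1"]) (auto simp: algebra_simps)
  next
    case 2
    then show ?thesis using *
      by (intro exI[of _ "n + 1"] exI[of _ "s + i"] exI[of _ m]) (auto simp: algebra_simps)
  qed
qed

lemma cong_solve:
  fixes a d :: int
  assumes "a > 0" "gcd a d = 1"
  shows "\<exists>j. 0 \<le> j \<and> j < a \<and> [j * d = i] (mod a)"
proof -
  have "coprime d a" using assms(2) by (simp add: coprime_iff_gcd_eq_1 gcd.commute)
  then obtain x where x: "[d * x = 1] (mod a)" using cong_solve_coprime_int by blast
  have "[(x * i) mod a * d = x * i * d] (mod a)" by (simp add: cong_def mod_mult_left_eq)
  also have "x * i * d = d * x * i" by simp
  also have "[d * x * i = 1 * i] (mod a)" using x cong_scalar_right by blast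
  finally show ?thesis using assms(1) by (intro exI[of _ "(x * i) mod a"]) auto
qed

text \<open>With \<open>j = k * p + u\<close>, the claimed value is reached by \<open>p\<close>
  copies of the last generator and one of index \<open>u\<close>. It is least in its class: a
  combination as in \<open>arith_gens_lin\<close> has \<open>s = j + a * l\<close> with
  \<open>l \<ge> 0\<close>, so \<open>n\<close> is at least
  \<open>ceil_div j k + (a div k) * l\<close>, and the surplus is at least
  \<open>a * l * (h * (a div k) + d)\<close>. The weak sign conditions let the lemma serve all the
  semigroups of the theorem.\<close>

lemma arith_semigroup:
  assumes "a > 0" "k \<ge> 1" "h \<ge> 0" "gcd a d = 1" "h * (a div k) + d \<ge> 0"
    and nonneg: "a * h + d \<ge> 0" "a * h + k * d \<ge> 0"
  defines "T \<equiv> sg_gen (arith_gens a h k d)"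
  shows "numerical_semigroup T" "a \<in> T"
    and "\<And>i j. 0 \<le> j \<Longrightarrow> j < a \<Longrightarrow> [j * d = i] (mod a)
      \<Longrightarrow> apery_elem T a i = ceil_div j k * (a * h) + j * d"
proof -
  let ?w = "\<lambda>j. ceil_div j k * (a * h) + j * d"
  have gens: "a \<in> T" "\<And>i. 1 \<le> i \<Longrightarrow> i \<le> k \<Longrightarrow> a * h + i * d \<in> T"
    unfolding T_def by (rule sg_gen_generator[OF finite_arith_gens]; force simp: arith_gens_def)+
  show "a \<in> T" by fact
  have closed: "x + y \<in> T" if "x \<in> T" "y \<in> T" for x y
    using that sg_gen_add unfolding T_def by blast
  have mem: "?w j \<in> T" if "0 \<le> j" for j
  proof (cases "j = 0")
    case True
    then show ?thesis using sg_gen_0 by (simp add: T_def)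
  next
    case False
    then have "k > 0" "j \<ge> 1" using \<open>k \<ge> 1\<close> that by auto
    then obtain p u where *: "p \<ge> 0" "1 \<le> u" "u \<le> k" "j = k * p + u"
      by (rule remainder_decomp)
    have "?w j = p * (a * h + k * d) + (a * h + u * d)"
      unfolding *(4) ceil_div_eq[OF *(2,3)] by (simp add: algebra_simps)
    moreover have "p * (a * h + k * d) \<in> T"
      using gens(2)[of k] \<open>k \<ge> 1\<close> sg_gen_mult * unfolding T_def by simp
    ultimately show ?thesis using gens(2)[of u] * closed by metis
  qed
  have least: "?w j \<le> x" if "x \<in> T" "0 \<le> j" "j < a" "[j * d = x] (mod a)" for x j
  proof -
    obtain n s m where *: "0 \<le> n" "0 \<le> s" "s \<le> k * n" "0 \<le> m" "x = n * (a * h) + s * d + m * a"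
      using arith_gens_lin[OF \<open>x \<in> T\<close>[unfolded T_def]] by blast
    have "[j * d = s * d] (mod a)"
    proof -
      have "[x = s * d] (mod a)" unfolding *(5) cong_iff_dvd_diff by (simp add: algebra_simps)
      then show ?thesis using that(4) cong_trans by blast
    qed
    then have "[j = s] (mod a)"
      using assms(4) by (simp add: cong_mult_rcancel coprime_iff_gcd_eq_1 gcd.commute)
    then obtain l where l: "s = j + a * l" by (metis cong_iff_lin)
    have l0: "l \<ge> 0"
    proof (rule ccontr)
      assume "\<not> l \<ge> 0"
      then have "a * l \<le> a * (-1)" using assms(1) by (intro mult_left_mono) auto
      then show False using l * that by simp
    qed
    have "k * ((a div k) * l) \<le> a * l"
    proof -
      have "k * (a div k) \<le> a" using assms(2) by (simp add: minus_mod_eq_mult_div[symmetric])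
      from mult_right_mono[OF this l0] show ?thesis by (simp add: mult.assoc)
    qed
    then have "ceil_div j k + (a div k) * l \<le> ceil_div s k"
      using ceil_div_add_mult assms(2) l by auto
    also have "\<dots> \<le> n" using * assms(2) by (simp add: ceil_div_le_iff)
    finally have "(ceil_div j k + (a div k) * l) * (a * h) \<le> n * (a * h)"
      using assms by (intro mult_right_mono) auto
    moreover have "(ceil_div j k + (a div k) * l) * (a * h) + s * d
        = ?w j + a * l * (h * (a div k) + d)"
      using l by (simp add: algebra_simps)
    moreover have "a * l * (h * (a div k) + d) \<ge> 0" using assms l0 by simp
    moreover have "m * a \<ge> 0" using * assms by simp
    ultimately show ?thesis using *(5) by linarith
  qed
  have cong: "[?w j = j * d] (mod a)" for j
    unfolding cong_iff_dvd_diff by simp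
  have "T \<subseteq> {0..}"
    unfolding T_def
  proof (rule sg_gen_subset[OF finite_arith_gens])
    have "a * h + i * d \<ge> 0" if "1 \<le> i" "i \<le> k" for i
    proof (cases "d \<ge> 0")
      case True
      then show ?thesis using assms that by simp
    next
      case False
      then have "k * d \<le> i * d" using that by (intro mult_right_mono_neg) auto
      then show ?thesis using nonneg by linarith
    qed
    then show "arith_gens a h k d \<subseteq> {0..}" using assms(1) unfolding arith_gens_def by auto
  qed auto
  then show "numerical_semigroup T"
  proof (rule numerical_semigroupI[OF assms(1)])
    show "\<exists>w\<in>T. [w = i] (mod a)" for i
      using cong_solve[OF assms(1,4), of i] mem cong cong_trans by blast
  qed (use closed gens sg_gen_0 T_def in auto)
  fix i j
  assume j: "0 \<le> j" "j < a" "[j * d = i] (mod a)"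
  show "apery_elem T a i = ?w j"
  proof (rule apery_elem_eqI[OF assms(1)])
    show "?w j - a \<notin> T"
    proof
      assume "?w j - a \<in> T"
      moreover have "[j * d = ?w j - a] (mod a)" unfolding cong_iff_dvd_diff by simp
      ultimately show False using least j assms(1) by force
    qed
    show "[?w j = i] (mod a)" using cong j(3) cong_trans by blast
  qed (use closed gens mem j in auto)
qed

text \<open>The case \<open>h = k = 1\<close> of the arithmetic family with difference
  \<open>b - a\<close>; there the Apery formula collapses to
  \<open>j * a + j * (b - a)\<close>.\<close>

lemma two_gen_semigroup:
  assumes "a > 0" "b > 0" "gcd a b = 1"
  shows "numerical_semigroup (sg_gen {a, b})" "a \<in> sg_gen {a, b}"
    and "\<And>i j. 0 \<le> j \<Longrightarrow> j < a \<Longrightarrow> [j * b = i] (mod a) \<Longrightarrow> apery_elem (sg_gen {a, b}) a i = j * b"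
proof -
  have eq: "sg_gen {a, b} = sg_gen (arith_gens a 1 1 (b - a))"
  proof -
    have "arith_gens a 1 1 (b - a) = {a, b}" unfolding arith_gens_def by auto
    then show ?thesis by simp
  qed
  have g: "gcd a (b - a) = 1" using assms(3) by (metis gcd_diff1 gcd.commute)
  show "numerical_semigroup (sg_gen {a, b})" "a \<in> sg_gen {a, b}"
    unfolding eq by (rule arith_semigroup; use assms g in simp)+
  fix i j
  assume j: "0 \<le> j" "j < a" "[j * b = i] (mod a)"
  have "[j * (b - a) = j * b] (mod a)" unfolding cong_iff_dvd_diff by (simp add: algebra_simps)
  then have "[j * (b - a) = i] (mod a)" using j(3) cong_trans by blast
  then show "apery_elem (sg_gen {a, b}) a i = j * b"
    unfolding eq using arith_semigroup(3)[of a 1 1 "b - a" j i] assms g j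
    by (simp add: algebra_simps)
qed

subsection \<open>Rays and two-dimensional cones\<close>

lemma ray_eq: "ray v = {c *\<^sub>R v |c. c \<ge> 0}"
  by (auto simp: cone_hull_expl)

text \<open>A point of a convex set is relatively interior iff each segment from the set to it can
  be prolonged beyond it. Prolonging from \<open>v\<close> itself forces a positive
  coefficient.\<close>

lemma rel_interior_ray:
  fixes v :: "'a::euclidean_space"
  assumes "v \<noteq> 0"
  shows "rel_interior (ray v) = {c *\<^sub>R v |c. c > 0}"
proof -
  have conv: "convex (ray v)" by (simp add: convex_cone_hull)
  have "v \<in> ray v" by (simp add: hull_inc)
  then have ne: "ray v \<noteq> {}" by blast
  show ?thesis
  proof (intro equalityI subsetI)
    fix z
    assume z: "z \<in> rel_interior (ray v)"
    then obtain c where c: "z = c *\<^sub>R v"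
      using rel_interior_subset ray_eq by blast
    obtain e where e: "e > 1" "(1 - e) *\<^sub>R v + e *\<^sub>R z \<in> ray v"
      using z \<open>v \<in> ray v\<close> convex_rel_interior_iff[OF conv ne] by blast
    then obtain c' where c': "c' \<ge> 0" "(1 - e) *\<^sub>R v + e *\<^sub>R z = c' *\<^sub>R v"
      using ray_eq by blast
    then have "(1 - e + e * c) *\<^sub>R v = c' *\<^sub>R v"
      unfolding c by (simp add: algebra_simps)
    then have "1 - e + e * c = c'" using assms by simp
    then have "e * c > 0" using e c' by linarith
    then have "c > 0" using e by (simp add: zero_less_mult_iff)
    then show "z \<in> {c *\<^sub>R v |c. c > 0}" using c by blast
  next
    fix z
    assume "z \<in> {c *\<^sub>R v |c. c > 0}"
    then obtain c where c: "z = c *\<^sub>R v" "c > 0" by blast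
    have "\<exists>e>1. (1 - e) *\<^sub>R x + e *\<^sub>R z \<in> ray v" if "x \<in> ray v" for x
    proof -
      obtain c' where c': "x = c' *\<^sub>R v" "c' \<ge> 0" using \<open>x \<in> ray v\<close> ray_eq by blast
      \<comment> \<open>Chosen so that \<open>(e - 1) * c' \<le> c\<close>; the summand 1 keeps the
        denominator positive when \<open>c' = 0\<close>.\<close>
      define e where "e = 1 + c / (c' + 1)"
      have "e > 1" using c c' by (simp add: e_def)
      have "(e - 1) * c' = c * (c' / (c' + 1))" by (simp add: e_def)
      also have "\<dots> \<le> c * 1" using c c' by (intro mult_left_mono) auto
      also have "\<dots> \<le> e * c" using c \<open>e > 1\<close> by simp
      finally have "(1 - e) * c' + e * c \<ge> 0" by (simp add: algebra_simps)
      moreover have "(1 - e) *\<^sub>R x + e *\<^sub>R z = ((1 - e) * c' + e * c) *\<^sub>R v"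
        unfolding c c' by (simp add: algebra_simps)
      ultimately show ?thesis using \<open>e > 1\<close> ray_eq by blast
    qed
    then show "z \<in> rel_interior (ray v)"
      using convex_rel_interior_iff[OF conv ne] by blast
  qed
qed

lemma ray_scaleR:
  fixes v :: "'a::real_vector"
  assumes "c > 0"
  shows "ray (c *\<^sub>R v) = ray v"
proof -
  have "{e *\<^sub>R c *\<^sub>R v |e. e \<ge> 0} = {e *\<^sub>R v |e. e \<ge> 0}"
  proof (intro equalityI subsetI)
    fix x
    assume "x \<in> {e *\<^sub>R c *\<^sub>R v |e. e \<ge> 0}"
    then obtain e where "x = (e * c) *\<^sub>R v" "e \<ge> 0" by auto
    then show "x \<in> {e *\<^sub>R v |e. e \<ge> 0}" using assms by force
  next
    fix x
    assume "x \<in> {e *\<^sub>R v |e. e \<ge> 0}"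
    then obtain e where "x = e *\<^sub>R v" "e \<ge> 0" by blast
    then have "x = (e / c) *\<^sub>R c *\<^sub>R v" "e / c \<ge> 0" using assms by auto
    then show "x \<in> {e *\<^sub>R c *\<^sub>R v |e. e \<ge> 0}" by blast
  qed
  then show ?thesis by (simp add: ray_eq)
qed

text \<open>The coefficient of \<open>t\<close> is nonnegative on the cone, so if it vanishes inside
  a segment it vanishes at both ends.\<close>

lemma ray_face_of_cone2:
  fixes r t :: "'a::real_vector"
  assumes indep: "\<And>l m. l *\<^sub>R r + m *\<^sub>R t = 0 \<Longrightarrow> l = 0 \<and> m = 0"
  shows "ray r face_of {l *\<^sub>R r + m *\<^sub>R t |l m. l \<ge> 0 \<and> m \<ge> 0}" (is "_ face_of ?F")
  unfolding face_of_def
proof (intro conjI ballI impI)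
  show "ray r \<subseteq> ?F" unfolding ray_eq by force
  show "convex (ray r)" by (simp add: convex_cone_hull)
  have key: "p \<in> ray r \<and> q \<in> ray r"
    if p: "p \<in> ?F" and q: "q \<in> ?F" and x: "x \<in> ray r" "x \<in> open_segment p q" for p q x
  proof -
    obtain l m where lm: "p = l *\<^sub>R r + m *\<^sub>R t" "l \<ge> 0" "m \<ge> 0" using p by blast
    obtain l' m' where lm': "q = l' *\<^sub>R r + m' *\<^sub>R t" "l' \<ge> 0" "m' \<ge> 0" using q by blast
    obtain u where u: "0 < u" "u < 1" "x = (1 - u) *\<^sub>R p + u *\<^sub>R q"
      using x(2) unfolding in_segment by blast
    obtain c where c: "x = c *\<^sub>R r" using x(1) ray_eq by blast
    have "((1 - u) * l + u * l' - c) *\<^sub>R r + ((1 - u) * m + u * m') *\<^sub>R t = 0"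
      using u(3) unfolding c lm lm' by (simp add: algebra_simps)
    then have "(1 - u) * m + u * m' = 0" using indep by blast
    moreover have "(1 - u) * m \<ge> 0" "u * m' \<ge> 0" using u lm lm' by auto
    ultimately have "(1 - u) * m = 0" "u * m' = 0" by linarith+
    then have "m = 0" "m' = 0" using u by auto
    then show ?thesis using lm lm' unfolding ray_eq by auto
  qed
  fix p q x
  assume "p \<in> ?F" "q \<in> ?F" "x \<in> ray r" "x \<in> open_segment p q"
  from key[OF this] show "p \<in> ray r" "q \<in> ray r" by auto
qed

text \<open>If both coefficients of \<open>v\<close> are positive, \<open>v\<close> is the midpoint
  of \<open>2 l r\<close> and \<open>2 m t\<close>. A face through \<open>v\<close> then contains
  \<open>2 l r\<close>, which is not on the ray of \<open>v\<close>.\<close>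

lemma extremal_rays_cone2:
  fixes r t :: "'a::real_vector"
  assumes indep: "\<And>l m. l *\<^sub>R r + m *\<^sub>R t = 0 \<Longrightarrow> l = 0 \<and> m = 0"
  shows "extremal_rays {l *\<^sub>R r + m *\<^sub>R t |l m. l \<ge> 0 \<and> m \<ge> 0} = {ray r, ray t}"
    (is "extremal_rays ?F = _")
proof (intro equalityI subsetI)
  have swap: "{l *\<^sub>R t + m *\<^sub>R r |l m. l \<ge> 0 \<and> m \<ge> 0} = ?F"
    by (auto simp: add.commute) (metis add.commute)+
  have nz: "r \<noteq> 0" "t \<noteq> 0" using indep[of 1 0] indep[of 0 1] by auto
  have "ray r face_of ?F" by (rule ray_face_of_cone2[OF indep])
  moreover have "ray t face_of ?F"
  proof -
    have "l = 0 \<and> m = 0" if "l *\<^sub>R t + m *\<^sub>R r = 0" for l m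
      using indep[of m l] that by (simp add: add.commute)
    from ray_face_of_cone2[of t r, OF this] show ?thesis unfolding swap .
  qed
  ultimately show "R \<in> extremal_rays ?F" if "R \<in> {ray r, ray t}" for R
    using that nz unfolding extremal_rays_def by blast
  fix R
  assume "R \<in> extremal_rays ?F"
  then obtain v where R: "R face_of ?F" "v \<noteq> 0" "R = ray v"
    unfolding extremal_rays_def by blast
  have "v \<in> R" unfolding R(3) by (simp add: hull_inc)
  then have "v \<in> ?F" using face_of_imp_subset[OF R(1)] by blast
  then obtain l m where v: "v = l *\<^sub>R r + m *\<^sub>R t" "l \<ge> 0" "m \<ge> 0" by blast
  consider "l > 0" "m > 0" | "m = 0" "l > 0" | "l = 0" "m > 0"
    using v R(2) by fastforce
  then show "R \<in> {ray r, ray t}"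
  proof cases
    case 1
    let ?p = "(2 * l) *\<^sub>R r" and ?q = "(2 * m) *\<^sub>R t"
    have "?p \<noteq> ?q" using indep[of "2 * l" "- (2 * m)"] 1 by auto
    moreover have "v = (1 - 1 / 2) *\<^sub>R ?p + (1 / 2) *\<^sub>R ?q" using v by simp
    ultimately have "v \<in> open_segment ?p ?q" unfolding in_segment
      by (intro conjI exI[of _ "1/2"]) auto
    moreover have "?p = (2 * l) *\<^sub>R r + 0 *\<^sub>R t" "?q = 0 *\<^sub>R r + (2 * m) *\<^sub>R t" by auto
    then have "?p \<in> ?F" "?q \<in> ?F"
      using 1 by (blast intro: order_refl mult_nonneg_nonneg less_imp_le zero_le_numeral)+
    ultimately have "?p \<in> R" using R(1) \<open>v \<in> R\<close> unfolding face_of_def by blast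
    then obtain c where "?p = c *\<^sub>R v" "c \<ge> 0" unfolding R(3) ray_eq by blast
    then have "(2 * l - c * l) *\<^sub>R r + (- c * m) *\<^sub>R t = 0"
      unfolding v by (simp add: algebra_simps)
    then have "2 * l - c * l = 0 \<and> - c * m = 0" by (rule indep)
    then show ?thesis using 1 by auto
  next
    case 2
    then show ?thesis using R(3) v ray_scaleR[of l r] by simp
  next
    case 3
    then show ?thesis using R(3) v ray_scaleR[of m t] by simp
  qed
qed

subsection \<open>The face of the group cone\<close>

text \<open>For remainders \<open>u\<close>, \<open>v\<close> in \<open>1..k\<close>, the rounded
  quotients of \<open>k * p + u\<close> and \<open>v\<close> add up exactly when there is a carry,
  \<open>u + v > k\<close>. Carries determine \<open>y\<close> first on \<open>1..k\<close>, then
  block by block.\<close>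

lemma ceil_div_additive_imp_linear:
  fixes y :: "int \<Rightarrow> real"
  assumes "1 < k" "k + 2 < a"
    and add: "\<And>i j. 1 \<le> i \<Longrightarrow> 1 \<le> j \<Longrightarrow> i + j < a
      \<Longrightarrow> ceil_div i k + ceil_div j k = ceil_div (i + j) k \<Longrightarrow> y (i + j) = y i + y j"
  shows "\<exists>\<alpha> \<beta>. \<forall>j. 1 \<le> j \<longrightarrow> j < a \<longrightarrow> y j = \<alpha> * real_of_int (ceil_div j k) + \<beta> * real_of_int j"
proof -
  have carry: "y (k * p + u + v) = y (k * p + u) + y v"
    if "p \<ge> 0" "1 \<le> u" "u \<le> k" "1 \<le> v" "v \<le> k" "u + v > k" "k * p + u + v < a" for p u v
  proof (rule add)
    have "k * p \<ge> 0" using that assms by simp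
    then show "1 \<le> k * p + u" using that by linarith
    have "ceil_div (k * (p + 1) + (u + v - k)) k = p + 1 + 1"
      by (rule ceil_div_eq) (use that in auto)
    then show "ceil_div (k * p + u) k + ceil_div v k = ceil_div (k * p + u + v) k"
      using ceil_div_eq[of u k p] ceil_div_eq_1[of v k] that by (simp add: algebra_simps)
  qed (use that in auto)
  have carry0: "y (u + v) = y u + y v"
    if "1 \<le> u" "u \<le> k" "1 \<le> v" "v \<le> k" "u + v > k" "u + v < a" for u v
    using carry[of 0 u v] that by simp
  \<comment> \<open>With the common partner \<open>k + 1 - u\<close>, the indices \<open>u\<close>
    and \<open>u + 1\<close> sum to \<open>k + 1\<close> and \<open>k + 2\<close>; so \<beta> is the
    increment of \<open>y\<close> at each step within \<open>1..k\<close>.\<close>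
  define \<beta> where "\<beta> = y (k + 2) - y (k + 1)"
  define \<alpha> where "\<alpha> = y 1 - \<beta>"
  have base: "u \<le> k \<longrightarrow> y u = \<alpha> + \<beta> * u" if "1 \<le> u" for u
    using that
  proof (induction u rule: int_ge_induct)
    case base
    then show ?case unfolding \<alpha>_def by simp
  next
    case (step u)
    show ?case
    proof
      assume "u + 1 \<le> k"
      then have "y (k + 1) = y u + y (k + 1 - u)" "y (u + 1 + (k + 1 - u)) = y (u + 1) + y (k + 1 - u)"
        using carry0[of u "k + 1 - u"] carry0[of "u + 1" "k + 1 - u"] step(1) assms by simp_all
      moreover have "u + 1 + (k + 1 - u) = k + 2" by simp
      ultimately have "y (u + 1) - y u = \<beta>" unfolding \<beta>_def by (simp only:)
      then show "y (u + 1) = \<alpha> + \<beta> * real_of_int (u + 1)"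
        using step(2) \<open>u + 1 \<le> k\<close> by (simp add: algebra_simps)
    qed
  qed
  \<comment> \<open>Adding \<open>k\<close> to a remainder \<open>u \<ge> 1\<close> always carries,
    which moves the formula to the next block.\<close>
  have gen: "k * int p + u < a \<longrightarrow> y (k * int p + u) = \<alpha> * (p + 1) + \<beta> * (k * int p + u)"
    if "1 \<le> u" "u \<le> k" for p u
  proof (induction p)
    case 0
    then show ?case using base that by simp
  next
    case (Suc p)
    show ?case
    proof
      assume "k * int (Suc p) + u < a"
      then have less: "k * int p + u + k < a" by (simp add: algebra_simps)
      then have "y (k * int p + u + k) = y (k * int p + u) + y k"
        by (intro carry) (use that assms in auto)
      moreover have "y (k * int p + u) = \<alpha> * (p + 1) + \<beta> * (k * int p + u)"
        using Suc less assms by auto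
      ultimately show "y (k * int (Suc p) + u) = \<alpha> * (Suc p + 1) + \<beta> * (k * int (Suc p) + u)"
        using base[of k] assms by (simp add: algebra_simps)
    qed
  qed
  have "y j = \<alpha> * real_of_int (ceil_div j k) + \<beta> * real_of_int j" if "1 \<le> j" "j < a" for j
  proof -
    have "k > 0" using assms by simp
    then obtain p u where *: "p \<ge> 0" "1 \<le> u" "u \<le> k" "j = k * p + u"
      using \<open>1 \<le> j\<close> by (rule remainder_decomp)
    have "ceil_div j k = p + 1" using ceil_div_eq[OF *(2,3)] *(4) by simp
    then show ?thesis using gen[OF *(2,3), of "nat p"] * that by simp
  qed
  then show ?thesis by blast
qed

lemma residue_labelling_bounds:
  assumes "residue_labelling J a"
  shows "1 \<le> J i" "J i < a"
  using assms bij_betwE unfolding residue_labelling_def by fastforce+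

lemma residue_labelling_index:
  assumes "residue_labelling J a" "1 \<le> j" "j < a"
  obtains i where "J i = j"
  using assms bij_betw_imp_surj_on unfolding residue_labelling_def
  by (metis (no_types, lifting) atLeastAtMost_iff imageE zle_diff1_eq)

text \<open>
  The labelling \<open>J\<close> stands for \<open>j\<close> in the residue \<open>j d\<close>, not for the residue itself.
\<close>

definition slope_dir :: "('n::finite \<Rightarrow> int) \<Rightarrow> real ^ 'n" where
  "slope_dir J = (\<chi> i. real_of_int (J i))"

text \<open>The solution \<alpha> \<open>ceil_div j k\<close> + \<beta> \<open>j\<close> with
  \<alpha> = \<open>a\<close> and \<beta> = \<open>- (a div k)\<close>, on the boundary \<alpha>
  \<open>(a div k)\<close> + \<beta> \<open>a\<close> = 0 of the planar cone.\<close>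

definition step_dir :: "('n::finite \<Rightarrow> int) \<Rightarrow> int \<Rightarrow> int \<Rightarrow> real ^ 'n" where
  "step_dir J a k = (\<chi> i. real_of_int (a * ceil_div (J i) k - (a div k) * J i))"

text \<open>The sum of two indices is \<open>J s + a * e\<close> with \<open>e\<close> in
  \<open>{0, 1}\<close>. For \<open>step_dir\<close>, a wrap-around raises the rounded quotient by
  at least \<open>a div k\<close>, and this pays for the \<open>(a div k) * a\<close> lost in the
  linear term.\<close>

lemma slope_step_cone:
  assumes J: "residue_labelling J a" and "k > 0" "l \<ge> 0" "m \<ge> 0"
  shows "l *\<^sub>R slope_dir J + m *\<^sub>R step_dir J a k \<in> group_cone J a"
  unfolding group_cone_def
proof (intro CollectI allI impI)
  fix i j s
  assume cong: "[J i + J j = J s] (mod a)"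
  note b = residue_labelling_bounds[OF J, of i] residue_labelling_bounds[OF J, of j]
    residue_labelling_bounds[OF J, of s]
  have "a dvd J i + J j - J s" using cong by (simp add: cong_iff_dvd_diff)
  then obtain e where e: "J i + J j - J s = a * e" by blast
  have e': "e = 0 \<or> e = 1"
  proof -
    have "a * e < a * 2" "a * (-1) < a * e" using b unfolding e[symmetric] by linarith+
    then have "e < 2" "-1 < e" using b by (simp_all only: mult_less_cancel_left_pos)
    then show ?thesis by linarith
  qed
  have "k * (a div k) \<le> a" using assms(2) by (simp add: minus_mod_eq_mult_div[symmetric])
  then have "ceil_div (J s) k + (a div k) * e \<le> ceil_div (J s + a * e) k"
    using ceil_div_add_mult[of k "(a div k) * e" "a * e" "J s"] assms(2) e' by auto
  also have "J s + a * e = J i + J j" using e by simp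
  also have "ceil_div (J i + J j) k \<le> ceil_div (J i) k + ceil_div (J j) k"
    by (rule ceil_div_add_le) fact
  finally have "a * (ceil_div (J s) k + (a div k) * e) \<le> a * (ceil_div (J i) k + ceil_div (J j) k)"
    using b by (intro mult_left_mono) auto
  moreover have "(a div k) * (J i + J j) = (a div k) * (J s + a * e)" using e by simp
  ultimately have t: "a * ceil_div (J s) k - (a div k) * J s
      \<le> (a * ceil_div (J i) k - (a div k) * J i) + (a * ceil_div (J j) k - (a div k) * J j)"
    by (simp add: algebra_simps)
  have r: "J s \<le> J i + J j" using e e' b by auto
  have "m * real_of_int (a * ceil_div (J s) k - (a div k) * J s)
      \<le> m * real_of_int ((a * ceil_div (J i) k - (a div k) * J i) + (a * ceil_div (J j) k - (a div k) * J j))"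
    using t assms(4) by (intro mult_left_mono) (simp_all only: of_int_le_iff)
  moreover have "l * real_of_int (J s) \<le> l * real_of_int (J i + J j)"
    using r assms(3) by (intro mult_left_mono) (simp_all only: of_int_le_iff)
  ultimately show "(l *\<^sub>R slope_dir J + m *\<^sub>R step_dir J a k) $ s
    \<le> (l *\<^sub>R slope_dir J + m *\<^sub>R step_dir J a k) $ i + (l *\<^sub>R slope_dir J + m *\<^sub>R step_dir J a k) $ j"
    unfolding slope_dir_def step_dir_def by (simp add: algebra_simps)
qed

text \<open>The equalities give the form \<alpha> \<open>ceil_div j k\<close> + \<beta>
  \<open>j\<close>. Two further inequalities of the cone give the signs: \<open>1 + 1 = 2\<close>
  yields \<alpha> \<ge> 0, and \<open>k + (a + 1 - k)\<close>, which is 1 modulo \<open>a\<close>,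
  yields \<beta> \<open>a\<close> + \<alpha> \<open>q\<close> \<ge> 0.\<close>

lemma tight_cone_slope_step:
  assumes J: "residue_labelling J a" and k: "1 < k" "k + 2 < a"
    and x: "x \<in> group_cone J a"
    and tight: "\<And>i j s. J i + J j = J s \<Longrightarrow> ceil_div (J i) k + ceil_div (J j) k = ceil_div (J s) k
      \<Longrightarrow> x $ i + x $ j = x $ s"
  shows "\<exists>l m. l \<ge> 0 \<and> m \<ge> 0 \<and> x = l *\<^sub>R slope_dir J + m *\<^sub>R step_dir J a k"
proof -
  define ix where "ix = inv_into UNIV J"
  have ix: "J (ix j) = j" if "1 \<le> j" "j < a" for j
    using residue_labelling_index[OF J that] unfolding ix_def by (metis UNIV_I f_inv_into_f rangeI)
  have ix': "ix (J i) = i" for i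
    using J unfolding ix_def residue_labelling_def by (simp add: bij_betw_imp_inj_on)
  have cone: "x $ ix j \<le> x $ ix i + x $ ix i'"
    if "1 \<le> i" "i < a" "1 \<le> i'" "i' < a" "1 \<le> j" "j < a" "[i + i' = j] (mod a)" for i i' j
    using x that ix unfolding group_cone_def by simp
  have "\<exists>\<alpha> \<beta>. \<forall>j. 1 \<le> j \<longrightarrow> j < a \<longrightarrow> x $ ix j = \<alpha> * real_of_int (ceil_div j k) + \<beta> * real_of_int j"
  proof (rule ceil_div_additive_imp_linear[OF k])
    fix i j
    assume "1 \<le> i" "1 \<le> j" "i + j < a" "ceil_div i k + ceil_div j k = ceil_div (i + j) k"
    then show "x $ ix (i + j) = x $ ix i + x $ ix j"
      using tight[of "ix i" "ix j" "ix (i + j)"] ix by simp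
  qed
  then obtain \<alpha> \<beta> where lin: "\<And>j. 1 \<le> j \<Longrightarrow> j < a \<Longrightarrow> x $ ix j = \<alpha> * real_of_int (ceil_div j k) + \<beta> * real_of_int j"
    by blast
  define q where "q = a div k"
  have \<alpha>: "\<alpha> \<ge> 0"
    using cone[of 1 1 2] lin[of 1] lin[of 2] k by (simp add: ceil_div_eq_1)
  have q\<alpha>: "\<beta> * a + \<alpha> * q \<ge> 0"
  proof -
    have a: "a = k * q + a mod k" unfolding q_def by simp
    have am: "0 \<le> a mod k" "a mod k < k" using k by auto
    \<comment> \<open>Written with a remainder in \<open>1..k\<close>, as \<open>ceil_div_eq\<close>
      demands.\<close>
    have eq: "a + 1 - k = k * (q - 1) + (a mod k + 1)" using a by (simp add: algebra_simps)
    have "ceil_div (a + 1 - k) k = q"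
      unfolding eq by (subst ceil_div_eq) (use am in auto)
    moreover have "x $ ix 1 \<le> x $ ix k + x $ ix (a + 1 - k)"
      by (rule cone) (use k in \<open>auto simp: cong_def\<close>)
    ultimately show ?thesis
      using lin[of 1] lin[of k] lin[of "a + 1 - k"] k by (simp add: ceil_div_eq_1 algebra_simps)
  qed
  \<comment> \<open>The coefficients solve \<open>m * a\<close> = \<alpha> and
    \<open>l - m * q\<close> = \<beta>.\<close>
  have "x = ((\<beta> * a + \<alpha> * q) / a) *\<^sub>R slope_dir J + (\<alpha> / a) *\<^sub>R step_dir J a k"
  proof (rule vec_eq_iff[THEN iffD2], rule allI)
    fix i
    have "x $ i = \<alpha> * ceil_div (J i) k + \<beta> * J i"
      using lin[of "J i"] residue_labelling_bounds[OF J, of i] ix' by simp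
    moreover have "a > 0" using k by simp
    ultimately show "x $ i = (((\<beta> * a + \<alpha> * q) / a) *\<^sub>R slope_dir J + (\<alpha> / a) *\<^sub>R step_dir J a k) $ i"
      unfolding slope_dir_def step_dir_def q_def by (simp add: field_simps)
  qed
  then show ?thesis using \<alpha> q\<alpha> k by (intro exI conjI) auto
qed

text \<open>Equalities tight at a relative interior point hold on the whole face, which gives one
  inclusion. Conversely, \<open>w\<close> has positive coefficients, so the segment from any
  \<open>x\<close> of the planar cone to \<open>w\<close> can be prolonged inside the group cone,
  and the face property puts \<open>x\<close> into \<open>F\<close>.\<close>

lemma face_eq_slope_step:
  assumes J: "residue_labelling J a" and k: "1 < k" "k + 2 < a"
    and F: "F face_of group_cone J a"
    and w: "w \<in> rel_interior F" "w = l0 *\<^sub>R slope_dir J + m0 *\<^sub>R step_dir J a k" "l0 > 0" "m0 > 0"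
  shows "F = {l *\<^sub>R slope_dir J + m *\<^sub>R step_dir J a k |l m. l \<ge> 0 \<and> m \<ge> 0}" (is "F = ?G")
proof (intro equalityI subsetI)
  have FC: "F \<subseteq> group_cone J a" using F by (rule face_of_imp_subset)
  have wF: "w \<in> F" using w(1) rel_interior_subset by blast
  fix x
  {
    assume x: "x \<in> F"
    have "convex F" "F \<noteq> {}" using F face_of_imp_convex x by auto
    then obtain e where e: "e > 1" "(1 - e) *\<^sub>R x + e *\<^sub>R w \<in> F"
      using w(1) x convex_rel_interior_iff by blast
    have "\<exists>l m. l \<ge> 0 \<and> m \<ge> 0 \<and> x = l *\<^sub>R slope_dir J + m *\<^sub>R step_dir J a k"
    proof (rule tight_cone_slope_step[OF J k])
      show "x \<in> group_cone J a" using x FC by blast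
      fix i j s
      assume eq: "J i + J j = J s" "ceil_div (J i) k + ceil_div (J j) k = ceil_div (J s) k"
      have "real_of_int (J s) = J i + J j"
        "real_of_int (ceil_div (J s) k) = ceil_div (J i) k + ceil_div (J j) k"
        using eq by simp_all
      then have ws: "w $ s = w $ i + w $ j"
        unfolding w(2) slope_dir_def step_dir_def by (simp add: algebra_simps)
      have cong: "[J i + J j = J s] (mod a)" using eq by simp
      then have "x $ s \<le> x $ i + x $ j" using x FC unfolding group_cone_def by blast
      moreover have "((1 - e) *\<^sub>R x + e *\<^sub>R w) $ s
          \<le> ((1 - e) *\<^sub>R x + e *\<^sub>R w) $ i + ((1 - e) *\<^sub>R x + e *\<^sub>R w) $ j"
        using e(2) FC cong unfolding group_cone_def by blast
      \<comment> \<open>The contribution of \<open>w\<close> cancels because of \<open>ws\<close>;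
        the negative factor \<open>1 - e\<close> reverses the inequality for
        \<open>x\<close>.\<close>
      then have "(e - 1) * (x $ i + x $ j) \<le> (e - 1) * x $ s"
        by (simp add: ws algebra_simps)
      then have "x $ i + x $ j \<le> x $ s" using e(1) by simp
      ultimately show "x $ i + x $ j = x $ s" by simp
    qed
    then show "x \<in> ?G" by blast
  }
  {
    assume "x \<in> ?G"
    then obtain l m where x: "x = l *\<^sub>R slope_dir J + m *\<^sub>R step_dir J a k" "l \<ge> 0" "m \<ge> 0"
      by blast
    show "x \<in> F"
    proof (cases "x = w")
      case False
      \<comment> \<open>Small enough that \<open>w + \<epsilon> *\<^sub>R (w - x)\<close> keeps
        nonnegative coefficients; the summands 1 guard against \<open>l = 0\<close> or
        \<open>m = 0\<close>.\<close>
      define \<epsilon> where "\<epsilon> = min (l0 / (l + 1)) (m0 / (m + 1))"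
      have \<epsilon>: "\<epsilon> > 0" unfolding \<epsilon>_def using w x by simp
      have "\<epsilon> \<le> l0 / (l + 1)" "\<epsilon> \<le> m0 / (m + 1)" unfolding \<epsilon>_def by simp_all
      then have "\<epsilon> * (l + 1) \<le> l0" "\<epsilon> * (m + 1) \<le> m0"
        using x by (simp_all add: pos_le_divide_eq)
      then have "l0 + \<epsilon> * (l0 - l) \<ge> 0" "m0 + \<epsilon> * (m0 - m) \<ge> 0"
        using \<epsilon> w(3,4) mult_pos_pos[OF \<epsilon> w(3)] mult_pos_pos[OF \<epsilon> w(4)]
        unfolding right_diff_distrib distrib_left by linarith+
      then have "(l0 + \<epsilon> * (l0 - l)) *\<^sub>R slope_dir J + (m0 + \<epsilon> * (m0 - m)) *\<^sub>R step_dir J a k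
          \<in> group_cone J a"
        by (intro slope_step_cone[OF J]) (use k in auto)
      also have "(l0 + \<epsilon> * (l0 - l)) *\<^sub>R slope_dir J + (m0 + \<epsilon> * (m0 - m)) *\<^sub>R step_dir J a k
          = w + \<epsilon> *\<^sub>R (w - x)"
        unfolding w(2) x by (simp add: algebra_simps)
      finally have z: "w + \<epsilon> *\<^sub>R (w - x) \<in> group_cone J a" .
      have "w \<in> open_segment x (w + \<epsilon> *\<^sub>R (w - x))"
        unfolding in_segment
      proof (intro conjI exI)
        show "x \<noteq> w + \<epsilon> *\<^sub>R (w - x)"
        proof
          assume "x = w + \<epsilon> *\<^sub>R (w - x)"
          then have "(1 + \<epsilon>) *\<^sub>R (w - x) = 0" by (simp add: algebra_simps)
          then show False using \<epsilon> False by simp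
        qed
        show "0 < 1 / (1 + \<epsilon>)" "1 / (1 + \<epsilon>) < 1" using \<epsilon> by auto
        \<comment> \<open>The convex combination is verified after clearing the denominator
          \<open>1 + \<epsilon>\<close>.\<close>
        have "(1 + \<epsilon>) *\<^sub>R ((1 - 1 / (1 + \<epsilon>)) *\<^sub>R x + (1 / (1 + \<epsilon>)) *\<^sub>R (w + \<epsilon> *\<^sub>R (w - x)))
            = ((1 + \<epsilon>) * (1 - 1 / (1 + \<epsilon>))) *\<^sub>R x + ((1 + \<epsilon>) * (1 / (1 + \<epsilon>))) *\<^sub>R (w + \<epsilon> *\<^sub>R (w - x))"
          by (simp only: scaleR_add_right scaleR_scaleR mult.assoc)
        also have "(1 + \<epsilon>) * (1 - 1 / (1 + \<epsilon>)) = \<epsilon>" using \<epsilon> by (simp add: field_simps)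
        also have "(1 + \<epsilon>) * (1 / (1 + \<epsilon>)) = 1" using \<epsilon> by simp
        also have "\<epsilon> *\<^sub>R x + 1 *\<^sub>R (w + \<epsilon> *\<^sub>R (w - x)) = (1 + \<epsilon>) *\<^sub>R w" by (simp add: algebra_simps)
        finally have eq: "(1 + \<epsilon>) *\<^sub>R ((1 - 1 / (1 + \<epsilon>)) *\<^sub>R x + (1 / (1 + \<epsilon>)) *\<^sub>R (w + \<epsilon> *\<^sub>R (w - x)))
            = (1 + \<epsilon>) *\<^sub>R w" .
        show "w = (1 - 1 / (1 + \<epsilon>)) *\<^sub>R x + (1 / (1 + \<epsilon>)) *\<^sub>R (w + \<epsilon> *\<^sub>R (w - x))"
          by (rule scaleR_left_imp_eq[OF _ eq[symmetric]]) (use \<epsilon> in simp)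
      qed
      moreover have "x \<in> group_cone J a" unfolding x(1)
        by (intro slope_step_cone[OF J]) (use k x in auto)
      ultimately show ?thesis using F z wF unfolding face_of_def by blast
    qed (use wF in simp)
  }
qed

text \<open>As \<open>k > 1\<close>, the rounded quotient is 1 at both indices 1 and 2 while the
  index doubles, so these two coordinates suffice.\<close>

lemma slope_step_independent:
  assumes J: "residue_labelling J a" and k: "1 < k" "k + 2 < a"
    and eq: "l *\<^sub>R slope_dir J + m *\<^sub>R step_dir J a k = 0"
  shows "l = 0 \<and> m = 0"
proof -
  obtain i where i: "J i = 1" using residue_labelling_index[OF J, of 1] k by auto
  obtain j where j: "J j = 2" using residue_labelling_index[OF J, of 2] k by auto
  have "l + m * (a - a div k) = 0"
    using arg_cong[OF eq, of "\<lambda>v. v $ i"] k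
    by (simp add: slope_dir_def step_dir_def i ceil_div_eq_1)
  moreover have "l * 2 + m * (a - (a div k) * 2) = 0"
    using arg_cong[OF eq, of "\<lambda>v. v $ j"] k
    by (simp add: slope_dir_def step_dir_def j ceil_div_eq_1)
  moreover have "m * a = 2 * (l + m * (a - a div k)) - (l * 2 + m * (a - (a div k) * 2))"
    by (simp add: algebra_simps)
  ultimately have "m * a = 0" by simp
  then have "m = 0" using k by simp
  then show ?thesis using \<open>l + m * (a - a div k) = 0\<close> by simp
qed

subsection \<open>Semigroups on the rays\<close>

text \<open>
  Otherwise, with \<open>\<rho> = a mod k\<close>, the generator \<open>a h + d\<close> is redundant: \<open>q\<close> copies of \<open>a h + k d\<close> and one
  of \<open>a h + (\<rho> + 1) d\<close> add up to \<open>a h + d\<close> plus the nonpositive multiple \<open>a (h q + d)\<close> of \<open>a\<close>.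
  The case \<open>\<rho> = 0\<close> is excluded by \<open>a h + k d = k (h q + d)\<close>.
\<close>

lemma minimally_generating_arith_gens_imp:
  assumes gen: "minimally_generating (arith_gens a h k d)"
    and "1 < k" "k < a" "h \<ge> 1" "gcd a d = 1" "a * h + k * d > a"
  shows "h * (a div k) + d > 0"
proof (rule ccontr)
  assume neg: "\<not> h * (a div k) + d > 0"
  define q where "q = a div k"
  define \<rho> where "\<rho> = a mod k"
  have a: "a = k * q + \<rho>" unfolding q_def \<rho>_def by simp
  have \<rho>: "0 \<le> \<rho>" "\<rho> < k" unfolding \<rho>_def using assms by auto
  have q: "q \<ge> 0" unfolding q_def using assms by (simp add: pos_imp_zdiv_nonneg_iff)
  have d: "d \<noteq> 0" using assms by auto
  have "a * h \<ge> a * 1" using assms by (intro mult_left_mono) auto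
  have "\<rho> \<noteq> 0"
  proof
    assume "\<rho> = 0"
    then have "a * h + k * d = k * (h * (a div k) + d)" using a by (simp add: q_def algebra_simps)
    also have "\<dots> \<le> 0" using neg assms by (simp add: mult_le_0_iff)
    finally show False using assms by simp
  qed
  \<comment> \<open>Ensures that \<open>a\<close> survives the removal of the generator
    \<open>a * h + d\<close>.\<close>
  have gt: "a * h + d > a"
  proof (cases "d \<ge> 0")
    case True
    then show ?thesis using \<open>a * h \<ge> a * 1\<close> d by simp
  next
    case False
    then have "k * d \<le> 1 * d" using assms by (intro mult_right_mono_neg) auto
    then show ?thesis using assms by simp
  qed
  let ?g = "a * h + 1 * d"
  let ?G = "arith_gens a h k d - {?g}"
  have fin: "finite ?G" using finite_arith_gens by simp
  have mem: "a * h + i * d \<in> sg_gen ?G" if "2 \<le> i" "i \<le> k" for i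
  proof (rule sg_gen_generator[OF fin])
    have "i * d \<noteq> 1 * d" using d that by simp
    then show "a * h + i * d \<in> ?G" using that unfolding arith_gens_def by force
  qed
  have "a \<in> sg_gen ?G"
    using gt by (intro sg_gen_generator[OF fin]) (auto simp: arith_gens_def)
  then have "- (h * q + d) * a \<in> sg_gen ?G"
    using neg by (intro sg_gen_mult) (auto simp: q_def)
  moreover have "q * (a * h + k * d) \<in> sg_gen ?G"
    using mem[of k] assms q by (intro sg_gen_mult) auto
  \<comment> \<open>The index \<rho> + 1 lies in \<open>2..k\<close> since 0 < \<rho> <
    \<open>k\<close>, so this is not the removed generator.\<close>
  moreover have "a * h + (\<rho> + 1) * d \<in> sg_gen ?G"
    by (rule mem) (use \<rho> \<open>\<rho> \<noteq> 0\<close> in auto)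
  ultimately have "- (h * q + d) * a + q * (a * h + k * d) + (a * h + (\<rho> + 1) * d) \<in> sg_gen ?G"
    by (blast intro: sg_gen_add)
  also have "- (h * q + d) * a + q * (a * h + k * d) + (a * h + (\<rho> + 1) * d)
      = - d * a + d * (k * q + \<rho>) + (a * h + d)"
    by (simp add: algebra_simps)
  also have "\<dots> = ?g" using a by simp
  finally have "?g \<in> sg_gen ?G" .
  moreover have "?g \<in> arith_gens a h k d" using assms unfolding arith_gens_def by auto
  ultimately show False using gen unfolding minimally_generating_def by blast
qed

text \<open>
  Multiplication by the unit \<open>d\<close> is an automorphism of \<open>\<int>/a\<close>, so relabelling by it fixes the cone.
\<close>

lemma residue_labelling_multiples:
  fixes \<sigma> :: "'n::finite \<Rightarrow> int"
  assumes \<sigma>: "residue_labelling \<sigma> a" and "gcd a d = 1" "a > 0"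
  obtains J :: "'n \<Rightarrow> int" where "residue_labelling J a" "\<And>i. [J i * d = \<sigma> i] (mod a)"
    "group_cone J a = group_cone \<sigma> a"
proof -
  have "\<forall>i. \<exists>j. 0 \<le> j \<and> j < a \<and> [j * d = \<sigma> i] (mod a)"
    using cong_solve[OF assms(3,2)] by blast
  then obtain J where J: "\<And>i. 0 \<le> J i" "\<And>i. J i < a" "\<And>i. [J i * d = \<sigma> i] (mod a)"
    by metis
  have \<sigma>b: "1 \<le> \<sigma> i" "\<sigma> i < a" for i using residue_labelling_bounds[OF \<sigma>] by auto
  have nz: "J i \<noteq> 0" for i
  proof
    assume "J i = 0"
    then have "0 mod a = \<sigma> i mod a" using J(3)[of i] by (simp add: cong_def)
    then show False using \<sigma>b[of i] by simp
  qed
  have "1 \<le> J i \<and> J i \<le> a - 1" for i using J(1)[of i] J(2)[of i] nz[of i] by linarith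
  then have sub: "J ` UNIV \<subseteq> {1..a - 1}" by auto
  have inj: "inj J"
  proof (rule injI)
    fix i j
    assume "J i = J j"
    then have "[\<sigma> i = \<sigma> j] (mod a)" using J(3) by (metis cong_sym cong_trans)
    then have "\<sigma> i = \<sigma> j" using \<sigma>b[of i] \<sigma>b[of j] by (simp add: cong_def)
    then show "i = j" using \<sigma> unfolding residue_labelling_def by (metis bij_betw_imp_inj_on inj_eq)
  qed
  \<comment> \<open>The labelling \<sigma> supplies the size of the index type, so injectivity of
    \<open>J\<close> gives surjectivity.\<close>
  have "card (J ` UNIV) = card {1..a - 1}"
    using inj \<sigma> card_image[OF inj] unfolding residue_labelling_def by (metis bij_betw_same_card)
  then have "J ` UNIV = {1..a - 1}" using sub by (intro card_subset_eq) auto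
  then have lab: "residue_labelling J a" using inj unfolding residue_labelling_def bij_betw_def by simp
  have "[J i + J j = J l] (mod a) \<longleftrightarrow> [\<sigma> i + \<sigma> j = \<sigma> l] (mod a)" for i j l
  proof -
    have "[J i + J j = J l] (mod a) \<longleftrightarrow> [(J i + J j) * d = J l * d] (mod a)"
      using assms by (simp add: cong_mult_rcancel coprime_iff_gcd_eq_1 gcd.commute)
    also have "\<dots> \<longleftrightarrow> [\<sigma> i + \<sigma> j = \<sigma> l] (mod a)"
      using J(3)[of i] J(3)[of j] J(3)[of l] unfolding distrib_right
      by (meson cong_add cong_sym cong_trans)
    finally show ?thesis .
  qed
  then have "group_cone J a = group_cone \<sigma> a" unfolding group_cone_def by simp
  with lab J(3) that show ?thesis by blast
qed

text \<open>With \<open>j = k * p + u\<close> and \<open>a - k * q = 1\<close> the entry becomes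
  \<open>a + p - q * u\<close>, where \<open>0 \<le> p < q\<close> and
  \<open>1 \<le> u \<le> k\<close>. So the entries of \<open>step_dir\<close> are reduced
  residues.\<close>

lemma step_bounds:
  assumes "k > 0" "k * q = a - 1" "1 \<le> j" "j < a"
  shows "0 < a * ceil_div j k - q * j" "a * ceil_div j k - q * j < a"
proof -
  obtain p u where *: "p \<ge> 0" "1 \<le> u" "u \<le> k" "j = k * p + u"
    using assms(1,3) by (rule remainder_decomp)
  have q: "q \<ge> 0"
  proof (rule ccontr)
    assume "\<not> q \<ge> 0"
    then have "k * q < 0" using assms(1) by (simp add: mult_pos_neg)
    then show False using assms by simp
  qed
  have "k * p < k * q" using * assms by linarith
  then have "p < q" using assms(1) by (simp only: mult_less_cancel_left_pos)
  have eq: "a * ceil_div j k - q * j = a + p - q * u"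
  proof -
    have "a * (p + 1) - q * (k * p + u) = (a - k * q) * p + a - q * u" by (simp add: algebra_simps)
    then show ?thesis using ceil_div_eq[OF *(2,3), of p] *(4) assms(2) by simp
  qed
  have "q * u \<le> q * k" "q * 1 \<le> q * u"
    by (rule mult_left_mono; use * q in simp)+
  then show "0 < a * ceil_div j k - q * j" "a * ceil_div j k - q * j < a"
    unfolding eq using assms(2) * \<open>p < q\<close> by (simp_all only: mult.commute[of q k])
qed

text \<open>Reduced solutions of \<open>c i * b = \<sigma> i\<close> modulo \<open>a\<close> thus
  span the ray of the semigroup; the entries of \<open>slope_dir\<close>, and of
  \<open>step_dir\<close> if \<open>k\<close> divides \<open>a - 1\<close>, are of this
  kind.\<close>

lemma apery_tuple_two_gen:
  assumes "a > 0" "b > 0" "gcd a b = 1"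
    and c: "\<And>i. 0 \<le> c i" "\<And>i. c i < a" "\<And>i. [c i * b = \<sigma> i] (mod a)"
  shows "apery_tuple \<sigma> a (sg_gen {a, b}) = real_of_int b *\<^sub>R (\<chi> i. real_of_int (c i))"
  unfolding apery_tuple_def using two_gen_semigroup(3)[OF assms(1-3) c]
  by (simp add: vec_eq_iff)

lemma contains_semigroup_ray_iff:
  assumes "v \<noteq> 0"
  shows "contains_semigroup \<sigma> m (ray v) S \<longleftrightarrow>
    numerical_semigroup S \<and> m \<in> S \<and> (\<exists>c>0. apery_tuple \<sigma> m S = c *\<^sub>R v)"
  unfolding contains_semigroup_def rel_interior_ray[OF assms] by blast

text \<open>Every element is its Apery element plus a nonnegative multiple of \<open>a\<close>. The
  class of 0 has no coordinate, so its elements are treated separately as multiples of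
  \<open>a\<close>.\<close>

lemma semigroup_eq_two_gen:
  assumes "a > 0" "numerical_semigroup T" "a \<in> T" "b \<in> T"
    and mult: "\<And>i. \<not> a dvd i \<Longrightarrow> \<exists>n\<ge>0. apery_elem T a i = n * b"
  shows "T = sg_gen {a, b}"
proof
  have T: "T \<subseteq> {0..}" "0 \<in> T" "\<And>x y. x \<in> T \<Longrightarrow> y \<in> T \<Longrightarrow> x + y \<in> T"
    using assms(2) unfolding numerical_semigroup_def by auto
  show "sg_gen {a, b} \<subseteq> T" by (rule sg_gen_subset) (use T assms in auto)
  have gens: "a \<in> sg_gen {a, b}" "b \<in> sg_gen {a, b}" by (auto intro: sg_gen_generator)
  show "T \<subseteq> sg_gen {a, b}"
  proof
    fix x
    assume x: "x \<in> T"
    show "x \<in> sg_gen {a, b}"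
    proof (cases "a dvd x")
      case True
      then obtain n where n: "x = n * a" by (metis dvdE mult.commute)
      then have "n \<ge> 0" using x T(1) assms(1) by (auto simp: zero_le_mult_iff)
      then show ?thesis unfolding n using gens sg_gen_mult by blast
    next
      case False
      then obtain n where n: "n \<ge> 0" "apery_elem T a x = n * b" using mult by blast
      note ap = apery_elem_props[OF assms(1-3), of x]
      have "apery_elem T a x \<le> x"
        by (rule apery_le[of a T]) (use assms x T ap cong_sym in auto)
      moreover obtain l where l: "x = apery_elem T a x + a * l" using ap(3) by (metis cong_iff_lin)
      ultimately have "l \<ge> 0" using assms(1) by (smt (verit) mult_pos_neg)
      then have "n * b + l * a \<in> sg_gen {a, b}"
        using n gens sg_gen_mult sg_gen_add by blast
      then show ?thesis using l n by (simp add: mult.commute)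
    qed
  qed
qed

theorem theorem4p6:
  fixes a h k d :: int
    and S S\<^sub>r S\<^sub>t :: "int set"
    and \<sigma> :: "'n::finite \<Rightarrow> int"
    and F :: "(real ^ 'n) set"
    and r t :: "real ^ 'n"
  assumes "residue_labelling \<sigma> a"
    and "extra_generalized_arithmetical a h k d S"
    and "minimally_generating (arith_gens a h k d)"
    and "1 < k" and "k < a - 2"
    and "F face_of group_cone \<sigma> a"
    and "contains_semigroup \<sigma> a F S"
    and "S\<^sub>r = sg_gen (arith_gens a h k (d + a))"
    and "S\<^sub>t = sg_gen (arith_gens a (h + a) k (d - a * \<lfloor>real_of_int a / real_of_int k\<rfloor>))"
    and "kunz_coords \<sigma> a S + r = kunz_coords \<sigma> a S\<^sub>r"
    and "kunz_coords \<sigma> a S + t = kunz_coords \<sigma> a S\<^sub>t"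
  shows "numerical_semigroup S\<^sub>r \<and> a \<in> S\<^sub>r \<and> numerical_semigroup S\<^sub>t \<and> a \<in> S\<^sub>t
    \<and> extremal_rays F = {ray r, ray t}
    \<and> (\<forall>b. b > 0 \<and> [b = d] (mod a) \<longrightarrow> contains_semigroup \<sigma> a (ray r) (sg_gen {a, b}))
    \<and> (k dvd a - 1 \<longrightarrow>
         (\<exists>T. contains_semigroup \<sigma> a (ray t) T) \<and>
         (\<forall>T. contains_semigroup \<sigma> a (ray t) T \<longrightarrow>
            (\<exists>b. b > 0 \<and> [b = k * d] (mod a) \<and> T = sg_gen {a, b})))"
proof -

  \<comment> \<open>Sign conditions from the hypotheses\<close>
  define q where "q = a div k"
  have S: "S = sg_gen (arith_gens a h k d)" and h: "h \<ge> 1" and g: "gcd a d = 1"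
    and big: "a * h + k * d > a"
    using assms(2) unfolding extra_generalized_arithmetical_def by auto
  have k: "1 < k" "k + 2 < a" and a: "a > 0" using assms(4,5) by auto
  \<comment> \<open>Strictness makes the coefficient of the Apery tuple of \<open>S\<close> along
    \<open>slope_dir\<close> positive.\<close>
  have hq: "h * q + d > 0"
    using minimally_generating_arith_gens_imp[OF assms(3)] k h g big unfolding q_def by auto
  have St: "S\<^sub>t = sg_gen (arith_gens a (h + a) k (d - a * q))"
    using assms(9) by (simp add: q_def floor_divide_of_int_eq)
  have q: "k * q \<le> a" "q \<ge> 0" "q \<le> a"
  proof -
    show "k * q \<le> a" unfolding q_def using k by (simp add: minus_mod_eq_mult_div[symmetric])
    show "q \<ge> 0" unfolding q_def using k by (simp add: pos_imp_zdiv_nonneg_iff)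
    then have "1 * q \<le> k * q" using k by (intro mult_right_mono) auto
    then show "q \<le> a" using \<open>k * q \<le> a\<close> by simp
  qed
  have pos: "a * h + d \<ge> 0"
  proof (cases "d \<ge> 0")
    case False
    then have "k * d \<le> 1 * d" using k by (intro mult_right_mono_neg) auto
    then show ?thesis using big a by simp
  qed (use a h in simp)

  \<comment> \<open>Relabelling of the residues as multiples of \<open>d\<close>\<close>
  obtain J :: "'n \<Rightarrow> int" where J: "residue_labelling J a" "\<And>i. [J i * d = \<sigma> i] (mod a)"
    and cone: "group_cone J a = group_cone \<sigma> a"
    using residue_labelling_multiples[OF assms(1) g a] by metis
  have Jb: "0 \<le> J i" "1 \<le> J i" "J i < a" for i
    using residue_labelling_bounds[OF J(1), of i] by auto
  \<comment> \<open>The same labelling serves \<open>S\<^sub>r\<close> with \<open>e = 1\<close> and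
    \<open>S\<^sub>t\<close> with \<open>e = - q\<close>.\<close>
  have J': "[J i * (d + a * e) = \<sigma> i] (mod a)" for i e
  proof -
    have "[J i * (d + a * e) = J i * d] (mod a)"
      unfolding cong_iff_dvd_diff by (simp add: algebra_simps)
    then show ?thesis using J(2) cong_trans by blast
  qed

  \<comment> \<open>Apery elements of the three semigroups\<close>
  have apS: "apery_elem S a (\<sigma> i) = ceil_div (J i) k * (a * h) + J i * d" for i
    unfolding S using arith_semigroup(3)[of a k h d "J i" "\<sigma> i"] a k h g hq pos big Jb J(2)
    by (simp add: q_def)

  have gcd_shift: "gcd a (d + a * e) = 1" for e
  proof -
    have "[d + a * e = d] (mod a)" unfolding cong_iff_dvd_diff by simp
    then show ?thesis using g by (metis cong_gcd_eq gcd.commute)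
  qed
  have gr: "gcd a (d + a) = 1" using gcd_shift[of 1] by simp
  have posr: "h * (a div k) + (d + a) \<ge> 0" "a * h + (d + a) \<ge> 0" "a * h + k * (d + a) \<ge> 0"
  proof -
    have "k * a \<ge> 0" using a k by simp
    then show "h * (a div k) + (d + a) \<ge> 0" "a * h + (d + a) \<ge> 0" "a * h + k * (d + a) \<ge> 0"
      unfolding distrib_left using hq pos big a by (simp_all add: q_def)
  qed
  have Sr: "numerical_semigroup S\<^sub>r" "a \<in> S\<^sub>r"
    and apr: "\<And>i. apery_elem S\<^sub>r a (\<sigma> i) = ceil_div (J i) k * (a * h) + J i * (d + a)"
    using arith_semigroup[of a k h "d + a"] a k h gr posr Jb J'[of _ 1] unfolding assms(8) by simp_all

  have gt: "gcd a (d - a * q) = 1"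
    using gcd_shift[of "- q"] by simp
  \<comment> \<open>The two shifts leave \<open>h * q + d\<close> unchanged; the other two
    quantities gain \<open>a * (a - q)\<close> and \<open>a * (a - k * q)\<close>.\<close>
  have post: "(h + a) * (a div k) + (d - a * q) \<ge> 0" "a * (h + a) + (d - a * q) \<ge> 0"
    "a * (h + a) + k * (d - a * q) \<ge> 0"
  proof -
    show "(h + a) * (a div k) + (d - a * q) \<ge> 0" using hq by (simp add: q_def algebra_simps)
    have "0 \<le> a * (a - q)" "0 \<le> a * (a - k * q)" using a q by simp_all
    then have "0 \<le> (a * h + d) + a * (a - q)" "0 \<le> (a * h + k * d) + a * (a - k * q)"
      using pos big a by linarith+
    moreover have "(a * h + d) + a * (a - q) = a * (h + a) + (d - a * q)"
      "(a * h + k * d) + a * (a - k * q) = a * (h + a) + k * (d - a * q)"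
      by (simp_all add: algebra_simps)
    ultimately show "a * (h + a) + (d - a * q) \<ge> 0" "a * (h + a) + k * (d - a * q) \<ge> 0"
      by (simp_all only:)
  qed
  have St': "numerical_semigroup S\<^sub>t" "a \<in> S\<^sub>t"
    and apt: "\<And>i. apery_elem S\<^sub>t a (\<sigma> i) = ceil_div (J i) k * (a * (h + a)) + J i * (d - a * q)"
    using arith_semigroup[of a k "h + a" "d - a * q"] a k h gt post Jb J'[of _ "- q"]
    unfolding St by simp_all

  \<comment> \<open>Identification of \<open>r\<close> and \<open>t\<close>\<close>
  have r: "r = slope_dir J"
  proof (rule vec_eq_iff[THEN iffD2], rule allI)
    fix i
    have "kunz_coords \<sigma> a S $ i + r $ i = kunz_coords \<sigma> a S\<^sub>r $ i"
      using assms(10) by (metis vector_add_component)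
    then show "r $ i = slope_dir J $ i"
      using a unfolding kunz_coords_def slope_dir_def by (simp add: apS apr field_simps)
  qed
  have t: "t = step_dir J a k"
  proof (rule vec_eq_iff[THEN iffD2], rule allI)
    fix i
    have "kunz_coords \<sigma> a S $ i + t $ i = kunz_coords \<sigma> a S\<^sub>t $ i"
      using assms(11) by (metis vector_add_component)
    \<comment> \<open>The Apery elements differ by \<open>a\<close> times the entry of
      \<open>step_dir\<close>, and Kunz coordinates divide by \<open>a\<close>.\<close>
    then have "real_of_int a * t $ i = real_of_int a * step_dir J a k $ i"
      using a unfolding kunz_coords_def step_dir_def q_def[symmetric]
      by (simp add: apS apt field_simps)
    then show "t $ i = step_dir J a k $ i" using a by simp
  qed
  have indep: "l = 0 \<and> m = 0" if "l *\<^sub>R r + m *\<^sub>R t = 0" for l m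
    using slope_step_independent[OF J(1) k] that unfolding r t by blast
  have nz: "r \<noteq> 0" "t \<noteq> 0" using indep[of 1 0] indep[of 0 1] by auto

  \<comment> \<open>The face and its extremal rays\<close>
  have "F = {l *\<^sub>R r + m *\<^sub>R t |l m. l \<ge> 0 \<and> m \<ge> 0}"
    unfolding r t
  proof (rule face_eq_slope_step[OF J(1) k])
    show "F face_of group_cone J a" using assms(6) cone by simp
    show "apery_tuple \<sigma> a S \<in> rel_interior F" using assms(7) unfolding contains_semigroup_def by simp
    show "apery_tuple \<sigma> a S = real_of_int (h * q + d) *\<^sub>R slope_dir J + real_of_int h *\<^sub>R step_dir J a k"
      unfolding apery_tuple_def slope_dir_def step_dir_def q_def[symmetric]
      by (simp add: vec_eq_iff apS algebra_simps)
    show "real_of_int (h * q + d) > 0" using hq by (simp only: of_int_0_less_iff)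
    show "real_of_int h > 0" using h by simp
  qed
  then have rays: "extremal_rays F = {ray r, ray t}" using extremal_rays_cone2[OF indep] by simp

  \<comment> \<open>Semigroups on the ray of \<open>r\<close>\<close>
  have rs: "contains_semigroup \<sigma> a (ray r) (sg_gen {a, b})" if b: "b > 0" "[b = d] (mod a)" for b
  proof -
    have gb: "gcd a b = 1" using b(2) g by (metis cong_gcd_eq gcd.commute)
    have "[J i * b = \<sigma> i] (mod a)" for i
      using cong_scalar_left[OF b(2), of "J i"] J(2) cong_trans by blast
    then have "apery_tuple \<sigma> a (sg_gen {a, b}) = real_of_int b *\<^sub>R r"
      unfolding r slope_dir_def using a b gb Jb by (intro apery_tuple_two_gen) auto
    then show ?thesis
      unfolding contains_semigroup_ray_iff[OF nz(1)] using two_gen_semigroup[OF a b(1) gb] b(1)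
      by (metis of_int_0_less_iff)
  qed

  \<comment> \<open>Semigroups on the ray of \<open>t\<close>\<close>
  have ts: "(\<exists>T. contains_semigroup \<sigma> a (ray t) T) \<and>
      (\<forall>T. contains_semigroup \<sigma> a (ray t) T \<longrightarrow> (\<exists>b. b > 0 \<and> [b = k * d] (mod a) \<and> T = sg_gen {a, b}))"
    if dvd: "k dvd a - 1"
  proof -
    have kq: "k * q = a - 1"
    proof -
      obtain e where e: "a - 1 = k * e" using dvd by blast
      then have "a = k * e + 1" by simp
      then have "q = e" unfolding q_def using k by (simp add: div_pos_pos_trivial)
      then show ?thesis using e by simp
    qed
    define c where "c i = a * ceil_div (J i) k - q * J i" for i
    have c: "0 < c i" "c i < a" for i
      using step_bounds[of k q a "J i"] kq k Jb unfolding c_def by auto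
    have tc: "t = (\<chi> i. real_of_int (c i))" unfolding t step_dir_def c_def q_def ..
    \<comment> \<open>Since \<open>k * q\<close> is -1 modulo \<open>a\<close>, multiplying
      \<open>c i\<close> by \<open>k\<close> gives \<open>J i\<close> modulo
      \<open>a\<close>.\<close>
    have cs: "[c i * b = \<sigma> i] (mod a)" if b: "[b = k * d] (mod a)" for b i
    proof -
      have "[c i * b = c i * (k * d)] (mod a)" by (rule cong_scalar_left[OF b])
      moreover have "c i * (k * d) = a * (ceil_div (J i) k * k * d) - (k * q) * (J i * d)"
        unfolding c_def by (simp add: algebra_simps)
      then have "c i * (k * d) - J i * d = a * (ceil_div (J i) k * k * d - J i * d)"
        unfolding kq by (simp add: algebra_simps)
      then have "[c i * (k * d) = J i * d] (mod a)" unfolding cong_iff_dvd_diff by simp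
      ultimately show ?thesis using J(2) cong_trans by blast
    qed
    \<comment> \<open>At index \<open>k\<close> the entry of \<open>t\<close> is
      \<open>a - q * k = 1\<close>, so the second generator can be read off there, in the class of
      \<open>k * d\<close>.\<close>
    obtain i0 where i0: "J i0 = k" using residue_labelling_index[OF J(1), of k] k by auto
    have c0: "c i0 = 1" using k kq unfolding c_def i0 by (simp add: ceil_div_eq_1 mult.commute)
    have \<sigma>0: "[\<sigma> i0 = k * d] (mod a)" using J(2)[of i0] i0 cong_sym by metis

    have ex: "\<exists>T. contains_semigroup \<sigma> a (ray t) T"
    proof -
      \<comment> \<open>Large enough that \<open>k * d + a * e\<close> is positive even for negative
        \<open>d\<close>.\<close>
      define e where "e = \<bar>k * d\<bar> + 1"
      have e: "e \<ge> 0" "k * d + e > 0" unfolding e_def by linarith+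
      define b where "b = k * d + a * e"
      have "1 * e \<le> a * e" using a e(1) by (intro mult_right_mono) auto
      then have b0: "b > 0" using e(2) unfolding b_def by linarith
      have b: "[b = k * d] (mod a)" unfolding b_def cong_iff_dvd_diff by simp
      have "coprime a k"
      proof (rule coprimeI)
        fix x
        assume "x dvd a" "x dvd k"
        then have "x dvd a - k * q" by simp
        then show "is_unit x" using kq by simp
      qed
      then have "coprime a (k * d)" using g by (simp add: coprime_iff_gcd_eq_1[symmetric])
      then have gb: "gcd a b = 1" using b by (metis cong_gcd_eq gcd.commute coprime_iff_gcd_eq_1)
      have "apery_tuple \<sigma> a (sg_gen {a, b}) = real_of_int b *\<^sub>R t"
        unfolding tc using a b0 gb c cs[OF b] by (intro apery_tuple_two_gen) (auto simp: less_imp_le)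
      then have "contains_semigroup \<sigma> a (ray t) (sg_gen {a, b})"
        unfolding contains_semigroup_ray_iff[OF nz(2)] using two_gen_semigroup[OF a b0 gb] b0
        by (metis of_int_0_less_iff)
      then show ?thesis ..
    qed
    have "\<exists>b. b > 0 \<and> [b = k * d] (mod a) \<and> T = sg_gen {a, b}"
      if T: "contains_semigroup \<sigma> a (ray t) T" for T
    proof -
      obtain e where T': "numerical_semigroup T" "a \<in> T" and e: "e > 0" "apery_tuple \<sigma> a T = e *\<^sub>R t"
        using T unfolding contains_semigroup_ray_iff[OF nz(2)] by blast
      define b where "b = apery_elem T a (\<sigma> i0)"
      have ap: "real_of_int (apery_elem T a (\<sigma> i)) = e * real_of_int (c i)" for i
        using arg_cong[OF e(2), of "\<lambda>v. v $ i"] unfolding apery_tuple_def tc by simp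
      \<comment> \<open>The entry 1 at \<open>i0\<close> forces the scaling factor to be an
        integer.\<close>
      have eb: "e = real_of_int b" using ap[of i0] c0 unfolding b_def by simp
      have apb: "apery_elem T a (\<sigma> i) = c i * b" for i
      proof -
        have "real_of_int (apery_elem T a (\<sigma> i)) = real_of_int (c i * b)"
          using ap[of i] unfolding eb by simp
        then show ?thesis by (simp only: of_int_eq_iff)
      qed
      have "[b = k * d] (mod a)"
        using apery_elem_props(3)[OF a T', of "\<sigma> i0"] \<sigma>0 cong_trans unfolding b_def by blast
      moreover have "T = sg_gen {a, b}"
      proof (rule semigroup_eq_two_gen[OF a T'])
        show "b \<in> T" unfolding b_def by (rule apery_elem_props(1)[OF a T'])
        fix i
        assume "\<not> a dvd i"
        then have "i mod a \<noteq> 0" by (simp add: dvd_eq_mod_eq_0)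
        then have "1 \<le> i mod a" "i mod a < a" using a pos_mod_sign[of a i] pos_mod_bound[of a i] by linarith+
        then obtain i1 where "\<sigma> i1 = i mod a" using residue_labelling_index[OF assms(1)] by metis
        \<comment> \<open>Apery elements depend only on the class, so the labelled residues cover
          every nonzero class.\<close>
        moreover have "apery_elem T a i = apery_elem T a (i mod a)"
          unfolding apery_elem_def by (simp add: cong_def)
        ultimately show "\<exists>n\<ge>0. apery_elem T a i = n * b" using apb[of i1] c(1)[of i1] by (metis less_imp_le)
      qed
      moreover have "b > 0" using e(1) eb by simp
      ultimately show ?thesis by blast
    qed
    with ex show ?thesis by blast
  qed
  show ?thesis using Sr St' rays rs ts by blast
qed

end
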